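(* Let $\alpha\in(0,1)$, let $H:(0,\infty)\to[0,\infty)$ be measurable, let $\phi(p)=\int_0^\infty z^{-1/p}H(z)\,dz$, and suppose that one of the following two cases holds. (a) For $p>1$, $\phi(p)<\infty$ if and only if $p>1/\alpha$; there is $\delta_0>0$ with $\int_1^\infty z^{-1+\delta_0}H(z)\,dz<\infty$; and there are constants $H_-\in(0,\infty)$, $\beta_1\ge0$, $\gamma>0$ and a non-negative continuous function $S_1$, slowly varying at infinity, such that as $z\to0+$ $$H(z)=H_-\,z^{\alpha-1}|\log z|^{\beta_1}S_1(|\log z|)\,\bigl(1+O(|\log z|^{-\gamma})\bigr).$$ In this case put $(A,B)=(1/\alpha,\infty)$. (b) For $p>1$, $\phi(p)<\infty$ if and only if $p<1/\alpha$; there is $\delta_0>0$ with $\int_0^1 z^{-\delta_0}H(z)\,dz<\infty$; and there are constants $H_+\in(0,\infty)$, $\beta_2\ge0$, $\gamma>0$ and a non-negative continuous function $S_2$, slowly varying at infinity, such that as $z\to\infty$ $$H(z)=H_+\,z^{\alpha-1}|\log z|^{\beta_2}S_2(|\log z|)\,\bigl(1+O(|\log z|^{-\gamma})\bigr).$$ In this case put $(A,B)=(1,1/\alpha)$. Let $T_Hf(x)=\int_0^\infty x^{-1}H(y/x)f(y)\,dy$, $x>0$, and for $\psi\in\Psi(A,B)$ let $\psi_{(\phi)}(p)=\phi(p)\psi(p)$, $p\in(A,B)$. Then for all $\psi\in\Psi(A,B)$ and $f\in G(\psi)$ $$\|T_Hf\|G(\psi_{(\phi)})\le V_H\,\|f\|G(\psi),$$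 where the exact (smallest possible) value of the constant $V_H$ is $1$; that is, $$\sup_{\psi\in\Psi(A,B)}\ \sup_{f\in G(\psi),\,f\neq0}\frac{\|T_Hf\|G(\psi_{(\phi)})}{\|f\|G(\psi)}=1.$$
   Context: Functions are on $(0,\infty)$ with Lebesgue measure, and $|f|_p=(\int_0^\infty|f(x)|^p\,dx)^{1/p}$. For $1\le A<B\le\infty$, $\Psi(A,B)$ is the set of continuous positive functions $\psi$ on $(A,B)$ such that the limits $\psi(A+0)$ and $\psi(B-0)$ exist (finite or infinite), $\inf_{p\in(A,B)}\psi(p)>0$, and both limits are positive. $G(\psi)$ is the space of measurable $f$ with $\|f\|G(\psi)=\sup_{p\in(A,B)}|f|_p/\psi(p)<\infty$. A function $S$ is slowly varying at infinity if $\lim_{z\to\infty}S(lz)/S(z)=1$ for every $l>0$. *)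

theory Defs
  imports "HOL-Analysis.Analysis" "HOL-Library.Landau_Symbols"
begin

text \<open>Functions on \<open>(0,\<infinity>)\<close> are total functions on the reals of which only the restriction
  to \<open>{0<..}\<close> is used. Norms take values in \<open>[0,\<infinity>]\<close>.\<close>

abbreviation leb_pos :: "real measure" where
  "leb_pos \<equiv> lebesgue_on {0<..}"

text \<open>Used for positive exponents only, so that \<open>\<infinity>\<close> is mapped to \<open>\<infinity>\<close>.\<close>

definition ennreal_powr :: "ennreal \<Rightarrow> real \<Rightarrow> ennreal" where
  "ennreal_powr x a = (if x = \<infinity> then \<infinity> else ennreal (enn2real x powr a))"

definition Lp_norm :: "real \<Rightarrow> (real \<Rightarrow> real) \<Rightarrow> ennreal" where
  "Lp_norm p f = ennreal_powr (\<integral>\<^sup>+ x. ennreal (\<bar>f x\<bar> powr p) \<partial>leb_pos) (1 / p)"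

text \<open>Members of \<open>Psi A B\<close> are finite-valued inside the interval, but the one-sided limits at
  its end points, one of which may be \<open>\<infinity>\<close>, are taken in the extended reals.\<close>

definition Psi :: "ereal \<Rightarrow> ereal \<Rightarrow> (real \<Rightarrow> real) set" where
  "Psi A B = {\<psi>. continuous_on (einterval A B) \<psi>
     \<and> (\<forall>p\<in>einterval A B. 0 < \<psi> p)
     \<and> 0 < (INF p\<in>einterval A B. ereal (\<psi> p))
     \<and> (\<exists>L>0. ((\<lambda>p. ereal (\<psi> (real_of_ereal p))) \<longlongrightarrow> L) (at_right A))
     \<and> (\<exists>L>0. ((\<lambda>p. ereal (\<psi> (real_of_ereal p))) \<longlongrightarrow> L) (at_left B))}"

text \<open>The weight \<open>w\<close> is extended-valued because \<open>\<phi>(p)\<close> below is.\<close>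

definition G_norm :: "ereal \<Rightarrow> ereal \<Rightarrow> (real \<Rightarrow> ennreal) \<Rightarrow> (real \<Rightarrow> real) \<Rightarrow> ennreal" where
  "G_norm A B w f = (SUP p\<in>einterval A B. Lp_norm p f / w p)"

definition G_space :: "ereal \<Rightarrow> ereal \<Rightarrow> (real \<Rightarrow> ennreal) \<Rightarrow> (real \<Rightarrow> real) set" where
  "G_space A B w = {f. f \<in> borel_measurable leb_pos \<and> G_norm A B w f < \<infinity>}"

definition slowly_varying :: "(real \<Rightarrow> real) \<Rightarrow> bool" where
  "slowly_varying S \<longleftrightarrow> (\<forall>l>0. ((\<lambda>z. S (l * z) / S z) \<longlongrightarrow> 1) at_top)"

definition phi :: "(real \<Rightarrow> real) \<Rightarrow> real \<Rightarrow> ennreal" where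
  "phi H p = (\<integral>\<^sup>+ z. ennreal (z powr (- 1 / p) * H z) \<partial>leb_pos)"

text \<open>\<open>H(z) = C z\<^bsup>\<alpha>-1\<^esup> |log z|\<^bsup>\<beta>\<^esup> S(|log z|) (1 + O(|log z|\<^bsup>-\<gamma>\<^esup>))\<close> along the filter \<open>F\<close>.\<close>

definition power_log_asymp ::
    "real \<Rightarrow> (real \<Rightarrow> real) \<Rightarrow> real filter \<Rightarrow> bool" where
  "power_log_asymp \<alpha> H F \<longleftrightarrow>
     (\<exists>C \<beta> \<gamma> S. 0 < C \<and> 0 \<le> \<beta> \<and> 0 < \<gamma>
        \<and> continuous_on {0<..} S \<and> (\<forall>u>0. 0 \<le> S u) \<and> slowly_varying S
        \<and> (\<exists>\<epsilon>. \<epsilon> \<in> O[F](\<lambda>z. \<bar>ln z\<bar> powr (- \<gamma>))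
             \<and> (\<forall>\<^sub>F z in F. H z = C * z powr (\<alpha> - 1) * \<bar>ln z\<bar> powr \<beta> * S \<bar>ln z\<bar> * (1 + \<epsilon> z))))"

definition singular_at_zero :: "real \<Rightarrow> (real \<Rightarrow> real) \<Rightarrow> bool" where
  "singular_at_zero \<alpha> H \<longleftrightarrow>
     (\<forall>p>1. phi H p < \<infinity> \<longleftrightarrow> p > 1 / \<alpha>)
     \<and> (\<exists>\<delta>>0. (\<integral>\<^sup>+ z. ennreal (z powr (- 1 + \<delta>) * H z) \<partial>lebesgue_on {1..}) < \<infinity>)
     \<and> power_log_asymp \<alpha> H (at_right 0)"

definition singular_at_infinity :: "real \<Rightarrow> (real \<Rightarrow> real) \<Rightarrow> bool" where
  "singular_at_infinity \<alpha> H \<longleftrightarrow>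
     (\<forall>p>1. phi H p < \<infinity> \<longleftrightarrow> p < 1 / \<alpha>)
     \<and> (\<exists>\<delta>>0. (\<integral>\<^sup>+ z. ennreal (z powr (- \<delta>) * H z) \<partial>lebesgue_on {0<..1}) < \<infinity>)
     \<and> power_log_asymp \<alpha> H at_top"

definition T_integrand :: "(real \<Rightarrow> real) \<Rightarrow> (real \<Rightarrow> real) \<Rightarrow> real \<Rightarrow> real \<Rightarrow> real" where
  "T_integrand H f x y = inverse x * H (y / x) * f y"

text \<open>Bochner integrals of non-integrable functions are \<open>0\<close> by convention, so \<open>T_op H f x\<close> is
  meaningful only where \<open>T_integrand H f x\<close> is integrable.\<close>

definition T_op :: "(real \<Rightarrow> real) \<Rightarrow> (real \<Rightarrow> real) \<Rightarrow> real \<Rightarrow> real" where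
  "T_op H f x = (\<integral>y. T_integrand H f x y \<partial>leb_pos)"

end

theory Submission
  imports Defs
begin

text \<open>After the substitution \<open>y = x z\<close> the operator is \<open>T\<^sub>H f x = \<integral> H z * f (x z) dz\<close>. Jensen's
  inequality for the measure \<open>z\<^bsup>-1/p\<^esup> H z dz\<close> of mass \<open>\<phi>(p)\<close>, Fubini and a dilation bound its
  norm on \<open>L\<^sub>p\<close> by \<open>\<phi>(p)\<close>, which gives the upper bound for every \<open>\<psi>\<close>. For sharpness, fix one
  \<open>q\<close> in \<open>(A, B)\<close> and take \<open>f x = x\<^bsup>-1/q\<^esup>\<close> on \<open>[1, e\<^bsup>L\<^esup>]\<close> with \<open>L = n\<^sup>2\<close>, and for \<open>\<psi>\<close> an explicit
  majorant of the \<open>L\<^sub>p\<close> norms of \<open>f\<close> with equality at \<open>q\<close>. If \<open>z\<close> is restricted to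
  \<open>[e\<^bsup>-n\<^esup>, e\<^bsup>n\<^esup>]\<close>, then \<open>f (x z) = x\<^bsup>-1/q\<^esup> z\<^bsup>-1/q\<^esup>\<close> for all \<open>x\<close> in \<open>[e\<^bsup>n\<^esup>, e\<^bsup>L-n\<^esup>]\<close>, so only the
  fraction \<open>2n / n\<^sup>2\<close> of the logarithmic length and the tails of \<open>\<phi>(q)\<close> are lost.\<close>

section \<open>Powers in the extended non-negative reals and Jensen's inequality\<close>

lemma ennreal_powr_ennreal: "0 \<le> a \<Longrightarrow> ennreal_powr (ennreal a) b = ennreal (a powr b)"
  by (simp add: ennreal_powr_def)

lemma ennreal_powr_mono:
  assumes "x \<le> y" "0 \<le> a"
  shows "ennreal_powr x a \<le> ennreal_powr y a"
  using assms
  by (cases x; cases y) (auto simp: ennreal_powr_def top_unique intro!: powr_mono2 ennreal_leI)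

lemma ennreal_powr_cmult:
  assumes "0 < c"
  shows "ennreal_powr (ennreal c * x) a = ennreal (c powr a) * ennreal_powr x a"
proof (cases x)
  case (real r)
  then show ?thesis using assms
    by (simp add: ennreal_mult[symmetric] ennreal_powr_ennreal powr_mult)
next
  case top
  then show ?thesis using assms
    by (simp add: ennreal_powr_def ennreal_mult_top)
qed

lemma ennreal_powr_measurable [measurable (raw)]:
  assumes [measurable]: "f \<in> borel_measurable M"
  shows "(\<lambda>x. ennreal_powr (f x) a) \<in> borel_measurable M"
  unfolding ennreal_powr_def by measurable

text \<open>The right side is the tangent at \<open>s powr p\<close> of the concave function
  \<open>u powr (1 / p)\<close>, evaluated at \<open>u = g powr p\<close>. It comes from Young's
  inequality for the product of \<open>g * t\<close> and \<open>1 / t\<close>.\<close>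

lemma powr_le_tangent:
  fixes g s p :: real
  assumes "1 < p" "0 \<le> g" "0 < s"
  shows "g \<le> s powr (1 - p) / p * g powr p + (1 - 1 / p) * s"
proof -
  define q where "q = p / (p - 1)"
  have q: "1 < q" "1 / p + 1 / q = 1" using assms(1) by (auto simp: q_def field_simps)
  \<comment> \<open>This scale makes \<open>t powr p = s powr (1 - p)\<close> and
    \<open>(1 / t) powr q = s\<close>, the two coefficients of the tangent.\<close>
  define t where "t = s powr ((1 - p) / p)"
  have "g * t * (1 / t) \<le> (g * t) powr p / p + (1 / t) powr q / q"
    using assms q by (intro Youngs_inequality) (auto simp: t_def)
  moreover have "(g * t) powr p = s powr (1 - p) * g powr p"
    using assms by (simp add: t_def powr_mult powr_powr)
  moreover have "1 / t = s powr ((p - 1) / p)"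
    by (simp add: t_def powr_minus_divide[symmetric] minus_divide_left)
  then have "(1 / t) powr q = s"
    using assms by (simp add: powr_powr q_def)
  moreover have "t \<noteq> 0" using assms by (simp add: t_def)
  moreover have "1 / q = 1 - 1 / p" using q by simp
  ultimately show ?thesis by (simp add: divide_inverse mult_ac)
qed

text \<open>The tangent inequality is integrated against \<open>w\<close>, with the point of
  tangency at the weighted mean of \<open>g powr p\<close>. The left integral may a priori be
  infinite. The cases where the right integral is 0 or infinite offer no such point and are treated
  apart.\<close>

lemma nn_integral_Jensen_powr:
  fixes w g :: "'a \<Rightarrow> real"
  assumes [measurable]: "w \<in> borel_measurable M" "g \<in> borel_measurable M"
    and w: "\<And>z. 0 \<le> w z" and g: "\<And>z. 0 \<le> g z" and p: "1 < p"
    and W: "(\<integral>\<^sup>+ z. ennreal (w z) \<partial>M) = ennreal W" "0 < W"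
  shows "ennreal_powr (\<integral>\<^sup>+ z. ennreal (w z * g z) \<partial>M) p
    \<le> ennreal (W powr (p - 1)) * (\<integral>\<^sup>+ z. ennreal (w z * g z powr p) \<partial>M)"
proof (cases "\<integral>\<^sup>+ z. ennreal (w z * g z powr p) \<partial>M")
  case top
  then show ?thesis using W by (simp add: ennreal_mult_top)
next
  case (real I)
  show ?thesis
  proof (cases "I = 0")
    case True
    then have "AE z in M. ennreal (w z * g z powr p) = 0"
      using real by (subst nn_integral_0_iff_AE[symmetric]) auto
    then have "AE z in M. ennreal (w z * g z) = 0"
      by eventually_elim (use w g in \<open>auto simp: ennreal_eq_0_iff mult_le_0_iff order.antisym\<close>)
    then have "(\<integral>\<^sup>+ z. ennreal (w z * g z) \<partial>M) = 0"
      by (subst nn_integral_0_iff_AE) auto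
    then show ?thesis by (simp add: ennreal_powr_def)
  next
    case False
    with real have I: "0 < I" by simp
    \<comment> \<open>The weighted power mean of \<open>g\<close>: this \<open>s\<close> minimises
      the bound obtained below, and both of its terms then add up to \<open>s * W\<close>.\<close>
    define s where "s = (I / W) powr (1 / p)"
    have s: "0 < s" using I W by (simp add: s_def)
    have "(\<integral>\<^sup>+ z. ennreal (w z * g z) \<partial>M)
      \<le> (\<integral>\<^sup>+ z. ennreal (s powr (1 - p) / p) * ennreal (w z * g z powr p)
            + ennreal ((1 - 1 / p) * s) * ennreal (w z) \<partial>M)"
    proof (rule nn_integral_mono)
      fix z
      have "w z * g z \<le> w z * (s powr (1 - p) / p * g z powr p + (1 - 1 / p) * s)"
        by (intro mult_left_mono powr_le_tangent p g s w)
      also have "\<dots> = s powr (1 - p) / p * (w z * g z powr p) + ((1 - 1 / p) * s) * w z"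
        by (simp add: algebra_simps)
      finally show "ennreal (w z * g z) \<le> ennreal (s powr (1 - p) / p) * ennreal (w z * g z powr p)
            + ennreal ((1 - 1 / p) * s) * ennreal (w z)"
        using s p w[of z]
        by (subst ennreal_mult[symmetric], simp, simp, subst ennreal_mult[symmetric])
          (auto simp flip: ennreal_plus intro!: ennreal_leI)
    qed
    also have "\<dots> = ennreal (s powr (1 - p) / p) * ennreal I + ennreal ((1 - 1 / p) * s) * ennreal W"
      using real W by (subst nn_integral_add) (auto simp: nn_integral_cmult)
    also have "\<dots> = ennreal (s powr (1 - p) / p * I + (1 - 1 / p) * s * W)"
      using s p I W by (simp flip: ennreal_mult ennreal_plus)
    also have "s powr (1 - p) / p * I + (1 - 1 / p) * s * W = s * W"
    proof -
      have "s powr p = I / W" using I W p by (simp add: s_def powr_powr)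
      then have "I = s powr p * W" using W by simp
      then have "s powr (1 - p) * I = (s powr (1 - p) * s powr p) * W" by simp
      also have "\<dots> = s * W" using s by (simp flip: powr_add)
      finally have "s powr (1 - p) / p * I = s * W / p" by simp
      then show ?thesis by (simp add: algebra_simps)
    qed
    finally have "ennreal_powr (\<integral>\<^sup>+ z. ennreal (w z * g z) \<partial>M) p \<le> ennreal_powr (ennreal (s * W)) p"
      using p by (intro ennreal_powr_mono) auto
    also have "\<dots> = ennreal (W powr (p - 1) * I)"
    proof -
      have "(s * W) powr p = I / W * W powr p"
        using s W I p by (simp add: powr_mult s_def powr_powr)
      also have "\<dots> = W powr (p - 1) * I" using W by (simp add: powr_diff)
      finally show ?thesis using s W by (simp add: ennreal_powr_ennreal)
    qed
    finally show ?thesis using real W by (simp add: ennreal_mult)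
  qed
qed

section \<open>Integration on the half-line: dilations, Borel representatives, Tonelli\<close>

lemma nn_integral_leb_pos:
  "(\<integral>\<^sup>+ x. f x \<partial>leb_pos) = (\<integral>\<^sup>+ x. f x * indicator {0<..} x \<partial>lborel)"
  by (simp add: nn_integral_restrict_space nn_integral_completion)

lemma AE_leb_pos: "(AE x in leb_pos. P x) \<longleftrightarrow> (AE x in lborel. 0 < x \<longrightarrow> P x)"
  by (simp add: AE_restrict_space_iff AE_completion_iff)

text \<open>Dilations preserve null sets, once the exceptional set is enlarged to a Borel null set.
  This allows \<open>H\<close> to be changed on a null set inside \<open>H (y / x)\<close>.\<close>

lemma AE_leb_pos_dilation:
  assumes "AE y in leb_pos. P y" "0 < x"
  shows "AE y in leb_pos. P (y / x)"
proof -
  from assms(1)[unfolded AE_leb_pos] obtain N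
    where N: "N \<in> null_sets lborel" "{y. \<not> (0 < y \<longrightarrow> P y)} \<subseteq> N"
    unfolding eventually_ae_filter by auto
  have "N \<in> sets borel" using N by auto
  then have "AE y in lborel. 0 + (1 / x) * y \<notin> N"
    using assms N by (intro AE_borel_affine[where P="\<lambda>y. y \<notin> N"] AE_not_in) auto
  then show ?thesis
    unfolding AE_leb_pos by eventually_elim (use N(2) assms(2) in \<open>force dest: divide_pos_pos\<close>)
qed

lemma nn_integral_leb_pos_dilation:
  fixes c :: real
  assumes f: "f \<in> borel_measurable leb_pos" and c: "0 < c"
  shows "(\<integral>\<^sup>+ y. f y \<partial>leb_pos) = ennreal c * (\<integral>\<^sup>+ z. f (c * z) \<partial>leb_pos)"
proof -
  have "indicator {0<..} (c * z) = (indicator {0<..} z :: ennreal)" for z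
    using c by (auto simp: indicator_def zero_less_mult_iff)
  moreover have "(\<lambda>x. f x * indicator {0<..} x) \<in> borel_measurable lebesgue"
    using f by (subst (asm) borel_measurable_restrict_space_iff_ennreal) auto
  ultimately show ?thesis
    using c by (simp add: nn_integral_restrict_space nn_integral_real_affine_lebesgue[where c=c and t=0])
qed

lemma borel_measurable_leb_pos: "f \<in> borel_measurable borel \<Longrightarrow> f \<in> borel_measurable leb_pos"
  by (intro measurable_restrict_space1 measurable_completion) simp

text \<open>Tonelli's theorem is applied to functions such as \<open>f (x * z)\<close>, whose joint
  measurability is immediate for Borel \<open>f\<close> but not for Lebesgue measurable
  \<open>f\<close>.\<close>

lemma borel_representative:
  fixes f :: "real \<Rightarrow> real"
  assumes "f \<in> borel_measurable leb_pos"
  obtains g where "g \<in> borel_measurable borel" "AE x in leb_pos. f x = g x"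
proof -
  have "(\<lambda>x. indicator {0<..} x *\<^sub>R f x) \<in> borel_measurable lebesgue"
    using assms by (subst (asm) borel_measurable_restrict_space_iff) auto
  from completion_ex_borel_measurable_real[OF this] obtain g where
    g: "g \<in> borel_measurable lborel" "AE x in lborel. indicator {0<..} x *\<^sub>R f x = g x" by blast
  show ?thesis
  proof
    show "g \<in> borel_measurable borel" using g by simp
    show "AE x in leb_pos. f x = g x"
      unfolding AE_leb_pos using g(2) by eventually_elim (auto simp: indicator_def)
  qed
qed

lemma nn_integral_leb_pos_swap:
  fixes F :: "real \<Rightarrow> real \<Rightarrow> ennreal"
  assumes [measurable]: "(\<lambda>(x, y). F x y) \<in> borel_measurable (borel \<Otimes>\<^sub>M borel)"
  shows "(\<integral>\<^sup>+ x. \<integral>\<^sup>+ y. F x y \<partial>leb_pos \<partial>leb_pos) = (\<integral>\<^sup>+ y. \<integral>\<^sup>+ x. F x y \<partial>leb_pos \<partial>leb_pos)"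
proof -
  let ?I = "indicator {0<..} :: real \<Rightarrow> ennreal"
  have "(\<integral>\<^sup>+ x. \<integral>\<^sup>+ y. F x y \<partial>leb_pos \<partial>leb_pos) = (\<integral>\<^sup>+ x. \<integral>\<^sup>+ y. F x y * ?I y * ?I x \<partial>lborel \<partial>lborel)"
    unfolding nn_integral_leb_pos by (subst nn_integral_multc) auto
  also have "\<dots> = (\<integral>\<^sup>+ y. \<integral>\<^sup>+ x. F x y * ?I y * ?I x \<partial>lborel \<partial>lborel)"
    by (rule lborel_pair.Fubini') measurable
  also have "\<dots> = (\<integral>\<^sup>+ y. \<integral>\<^sup>+ x. F x y * ?I x * ?I y \<partial>lborel \<partial>lborel)"
    by (simp add: mult_ac)
  also have "\<dots> = (\<integral>\<^sup>+ y. \<integral>\<^sup>+ x. F x y \<partial>leb_pos \<partial>leb_pos)"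
    unfolding nn_integral_leb_pos by (subst nn_integral_multc) auto
  finally show ?thesis .
qed

section \<open>The operator and its bound on each L_p\<close>

lemma T_integrand_measurable:
  assumes "H \<in> borel_measurable leb_pos" "f \<in> borel_measurable leb_pos" "0 < x"
  shows "T_integrand H f x \<in> borel_measurable leb_pos"
proof -
  have "(\<lambda>y. y / x) = (*\<^sub>R) (1 / x)" by auto
  then have "(\<lambda>y. y / x) \<in> lebesgue \<rightarrow>\<^sub>M lebesgue"
    by (simp only: lebesgue_measurable_scaling)
  then have "(\<lambda>y. y / x) \<in> leb_pos \<rightarrow>\<^sub>M leb_pos"
    using assms(3) by (intro measurable_restrict_space3) auto
  then have "(\<lambda>y. H (y / x)) \<in> borel_measurable leb_pos"
    using assms(1) by (rule measurable_compose)
  then show ?thesis unfolding T_integrand_def[abs_def] using assms(2) by measurable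
qed

text \<open>Substitute \<open>y = x * z\<close>: the Jacobian \<open>x\<close> cancels the factor
  \<open>inverse x\<close>. Both sides may be infinite.\<close>

lemma nn_integral_T_integrand:
  assumes H: "H \<in> borel_measurable leb_pos" "\<And>z. 0 < z \<Longrightarrow> 0 \<le> H z"
    and f: "f \<in> borel_measurable leb_pos" and x: "0 < x"
  shows "(\<integral>\<^sup>+ y. ennreal \<bar>T_integrand H f x y\<bar> \<partial>leb_pos)
    = (\<integral>\<^sup>+ z. ennreal (H z * \<bar>f (x * z)\<bar>) \<partial>leb_pos)"
proof -
  note [measurable] = T_integrand_measurable[OF H(1) f x]
  have "(\<lambda>z. x * z) = (*\<^sub>R) x" by auto
  then have "(\<lambda>z. x * z) \<in> lebesgue \<rightarrow>\<^sub>M lebesgue"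
    by (simp only: lebesgue_measurable_scaling)
  then have [measurable]: "(\<lambda>z. x * z) \<in> leb_pos \<rightarrow>\<^sub>M leb_pos"
    using x by (intro measurable_restrict_space3) auto
  have "(\<integral>\<^sup>+ y. ennreal \<bar>T_integrand H f x y\<bar> \<partial>leb_pos)
      = ennreal x * (\<integral>\<^sup>+ z. ennreal \<bar>T_integrand H f x (x * z)\<bar> \<partial>leb_pos)"
    by (rule nn_integral_leb_pos_dilation[OF _ x]) simp
  also have "\<dots> = (\<integral>\<^sup>+ z. ennreal x * ennreal \<bar>T_integrand H f x (x * z)\<bar> \<partial>leb_pos)"
    by (rule nn_integral_cmult[symmetric]) measurable
  also have "\<dots> = (\<integral>\<^sup>+ z. ennreal (H z * \<bar>f (x * z)\<bar>) \<partial>leb_pos)"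
    using x H by (intro nn_integral_cong) (simp add: T_integrand_def abs_mult flip: ennreal_mult)
  finally show ?thesis .
qed

text \<open>The weight \<open>z\<^bsup>-1/p\<^esup> H z\<close> is chosen so that the dilation by \<open>z\<close> cancels the factor
  \<open>z\<close> left over by Jensen's inequality.\<close>

lemma nn_integral_kernel_powr_le:
  assumes [measurable]: "H \<in> borel_measurable borel" "f \<in> borel_measurable borel"
    and H: "\<And>z. 0 \<le> H z" and p: "1 < p" and phi: "phi H p = ennreal \<Phi>" "0 < \<Phi>"
  shows "(\<integral>\<^sup>+ x. ennreal_powr (\<integral>\<^sup>+ z. ennreal (H z * \<bar>f (x * z)\<bar>) \<partial>leb_pos) p \<partial>leb_pos)
    \<le> ennreal (\<Phi> powr p) * (\<integral>\<^sup>+ x. ennreal (\<bar>f x\<bar> powr p) \<partial>leb_pos)"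
proof -
  define w where "w z = z powr (- 1 / p) * H z" for z
  have [measurable]: "w \<in> borel_measurable borel" by (simp add: w_def[abs_def])
  have w: "0 \<le> w z" for z by (simp add: w_def H)
  note [intro!] = borel_measurable_leb_pos
  have "(\<integral>\<^sup>+ x. ennreal_powr (\<integral>\<^sup>+ z. ennreal (H z * \<bar>f (x * z)\<bar>) \<partial>leb_pos) p \<partial>leb_pos)
    \<le> (\<integral>\<^sup>+ x. ennreal (\<Phi> powr (p - 1)) * (\<integral>\<^sup>+ z. ennreal (w z * (z * \<bar>f (x * z)\<bar> powr p)) \<partial>leb_pos) \<partial>leb_pos)"
  proof (rule nn_integral_mono)
    fix x :: real
    define g where "g z = z powr (1 / p) * \<bar>f (x * z)\<bar>" for z
    have "(\<integral>\<^sup>+ z. ennreal (H z * \<bar>f (x * z)\<bar>) \<partial>leb_pos) = (\<integral>\<^sup>+ z. ennreal (w z * g z) \<partial>leb_pos)"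
    proof (rule nn_integral_cong)
      fix z assume "z \<in> space leb_pos"
      then have "z powr (- 1 / p) * z powr (1 / p) = 1" by (simp flip: powr_add)
      then show "ennreal (H z * \<bar>f (x * z)\<bar>) = ennreal (w z * g z)"
        by (simp add: w_def g_def mult_ac)
    qed
    also have "ennreal_powr \<dots> p \<le> ennreal (\<Phi> powr (p - 1)) * (\<integral>\<^sup>+ z. ennreal (w z * g z powr p) \<partial>leb_pos)"
      using phi p w by (intro nn_integral_Jensen_powr) (auto simp: g_def phi_def w_def[abs_def])
    also have "(\<integral>\<^sup>+ z. ennreal (w z * g z powr p) \<partial>leb_pos)
      = (\<integral>\<^sup>+ z. ennreal (w z * (z * \<bar>f (x * z)\<bar> powr p)) \<partial>leb_pos)"
      using p by (intro nn_integral_cong) (simp add: g_def powr_mult powr_powr)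
    finally show "ennreal_powr (\<integral>\<^sup>+ z. ennreal (H z * \<bar>f (x * z)\<bar>) \<partial>leb_pos) p
      \<le> ennreal (\<Phi> powr (p - 1)) * (\<integral>\<^sup>+ z. ennreal (w z * (z * \<bar>f (x * z)\<bar> powr p)) \<partial>leb_pos)" .
  qed
  also have "\<dots> = ennreal (\<Phi> powr (p - 1)) *
      (\<integral>\<^sup>+ x. \<integral>\<^sup>+ z. ennreal (w z * (z * \<bar>f (x * z)\<bar> powr p)) \<partial>leb_pos \<partial>leb_pos)"
    \<comment> \<open>With the inner integral taken over \<open>lborel\<close>, its measurability in
      \<open>x\<close> follows from joint Borel measurability.\<close>
    unfolding nn_integral_leb_pos[of "\<lambda>z. ennreal (w z * (z * \<bar>f (_ * z)\<bar> powr p))"]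
    by (subst nn_integral_cmult) auto
  also have "(\<integral>\<^sup>+ x. \<integral>\<^sup>+ z. ennreal (w z * (z * \<bar>f (x * z)\<bar> powr p)) \<partial>leb_pos \<partial>leb_pos)
    = (\<integral>\<^sup>+ z. \<integral>\<^sup>+ x. ennreal (w z * (z * \<bar>f (x * z)\<bar> powr p)) \<partial>leb_pos \<partial>leb_pos)"
    by (rule nn_integral_leb_pos_swap) measurable
  also have "\<dots> = (\<integral>\<^sup>+ z. ennreal (w z) * (\<integral>\<^sup>+ x. ennreal (\<bar>f x\<bar> powr p) \<partial>leb_pos) \<partial>leb_pos)"
  proof (rule nn_integral_cong)
    fix z assume "z \<in> space leb_pos"
    then have z: "0 < z" by simp
    have "(\<integral>\<^sup>+ x. ennreal (w z * (z * \<bar>f (x * z)\<bar> powr p)) \<partial>leb_pos)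
      = (\<integral>\<^sup>+ x. ennreal (w z) * (ennreal z * ennreal (\<bar>f (z * x)\<bar> powr p)) \<partial>leb_pos)"
      using z w by (intro nn_integral_cong) (simp add: mult.commute flip: ennreal_mult)
    also have "\<dots> = ennreal (w z) * (ennreal z * (\<integral>\<^sup>+ x. ennreal (\<bar>f (z * x)\<bar> powr p) \<partial>leb_pos))"
      by (subst nn_integral_cmult, force, subst nn_integral_cmult) auto
    also have "ennreal z * (\<integral>\<^sup>+ x. ennreal (\<bar>f (z * x)\<bar> powr p) \<partial>leb_pos) = (\<integral>\<^sup>+ x. ennreal (\<bar>f x\<bar> powr p) \<partial>leb_pos)"
      using z by (intro nn_integral_leb_pos_dilation[symmetric]) auto
    finally show "(\<integral>\<^sup>+ x. ennreal (w z * (z * \<bar>f (x * z)\<bar> powr p)) \<partial>leb_pos)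
      = ennreal (w z) * (\<integral>\<^sup>+ x. ennreal (\<bar>f x\<bar> powr p) \<partial>leb_pos)" .
  qed
  also have "\<dots> = phi H p * (\<integral>\<^sup>+ x. ennreal (\<bar>f x\<bar> powr p) \<partial>leb_pos)"
    by (subst nn_integral_multc) (auto simp: phi_def w_def)
  also have "ennreal (\<Phi> powr (p - 1)) * \<dots> = ennreal (\<Phi> powr p) * (\<integral>\<^sup>+ x. ennreal (\<bar>f x\<bar> powr p) \<partial>leb_pos)"
    using phi by (simp add: powr_diff mult.assoc[symmetric] flip: ennreal_mult)
  finally show ?thesis .
qed

lemma T_integrand_cong_AE:
  assumes "AE z in leb_pos. H z = H' z" "AE y in leb_pos. f y = f' y" "0 < x"
  shows "AE y in leb_pos. T_integrand H f x y = T_integrand H' f' x y"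
  using AE_leb_pos_dilation[OF assms(1,3)] assms(2)
  by eventually_elim (simp add: T_integrand_def)

lemma T_op_measurable_borel:
  assumes [measurable]: "H \<in> borel_measurable borel" "f \<in> borel_measurable borel"
  shows "T_op H f \<in> borel_measurable leb_pos"
proof -
  have "T_op H f = (\<lambda>x. \<integral>y. indicator {0<..} y *\<^sub>R T_integrand H f x y \<partial>lborel)"
    unfolding T_op_def T_integrand_def
    by (subst integral_restrict_space, simp, subst integral_completion) auto
  also have "\<dots> \<in> borel_measurable borel"
    unfolding T_integrand_def by (intro lborel.borel_measurable_lebesgue_integral) measurable
  finally show ?thesis by (rule borel_measurable_leb_pos)
qed

text \<open>If the integrand is not integrable, the left side is 0 by convention, so the bound holds
  at every \<open>x\<close>.\<close>

lemma ennreal_abs_T_op_le: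
  "ennreal \<bar>T_op H f x\<bar> \<le> (\<integral>\<^sup>+ y. ennreal \<bar>T_integrand H f x y\<bar> \<partial>leb_pos)"
proof (cases "integrable leb_pos (T_integrand H f x)")
  case True
  from integral_norm_bound_ennreal[OF this] show ?thesis by (simp add: T_op_def)
next
  case False
  then show ?thesis by (simp add: T_op_def not_integrable_integral_eq)
qed

lemma Lp_norm_cong_AE:
  assumes "AE x in leb_pos. f x = g x"
  shows "Lp_norm p f = Lp_norm p g"
proof -
  have "AE x in leb_pos. ennreal (\<bar>f x\<bar> powr p) = ennreal (\<bar>g x\<bar> powr p)"
    using assms by eventually_elim simp
  then show ?thesis unfolding Lp_norm_def by (subst nn_integral_cong_AE) auto
qed

text \<open>Borel representatives of \<open>H\<close> and \<open>f\<close> reduce all three claims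
  to the Borel case. The kernel estimate bounds the integral of the p-th power of \<open>K\<close>,
  where \<open>K\<close> dominates the operator and is finite exactly where the integrand is
  integrable.\<close>

lemma T_op_bounded:
  assumes H: "H \<in> borel_measurable leb_pos" "\<And>z. 0 < z \<Longrightarrow> 0 \<le> H z"
    and f: "f \<in> borel_measurable leb_pos"
    and p: "1 < p" and phi: "0 < phi H p" "phi H p < \<infinity>"
  shows T_op_measurable: "T_op H f \<in> borel_measurable leb_pos"
    and Lp_norm_T_op_le: "Lp_norm p (T_op H f) \<le> phi H p * Lp_norm p f"
    and AE_integrable_T_integrand:
      "Lp_norm p f < \<infinity> \<Longrightarrow> AE x in leb_pos. integrable leb_pos (T_integrand H f x)"
proof -
  obtain h where h: "h \<in> borel_measurable borel" "AE x in leb_pos. H x = h x"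
    using borel_representative[OF H(1)] by blast
  \<comment> \<open>A representative of \<open>H\<close> may be negative on a null set or outside
    the half-line; the cut makes it non-negative everywhere.\<close>
  define H' where "H' z = max 0 (h z)" for z
  have [measurable]: "H' \<in> borel_measurable borel" and H'0: "\<And>z. 0 \<le> H' z"
    using h(1) by (auto simp: H'_def[abs_def])
  have HH': "AE x in leb_pos. H x = H' x"
    using h(2) unfolding AE_leb_pos by eventually_elim (use H(2) in \<open>force simp: H'_def\<close>)
  obtain f' where f': "f' \<in> borel_measurable borel" "AE x in leb_pos. f x = f' x"
    using borel_representative[OF f] by blast
  note [measurable] = f'(1)
  have meas: "T_integrand H f x \<in> borel_measurable leb_pos"
      "T_integrand H' f' x \<in> borel_measurable leb_pos" if "0 < x" for x
    using that H f by (auto intro!: T_integrand_measurable intro: borel_measurable_leb_pos)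
  \<comment> \<open>Equality holds at every positive \<open>x\<close>, not just almost everywhere,
    since for each \<open>x\<close> the integrands differ only on a null set of
    \<open>y\<close>.\<close>
  have T_eq: "T_op H f x = T_op H' f' x" if "0 < x" for x
    unfolding T_op_def using that
    by (intro integral_cong_AE meas T_integrand_cong_AE HH' f')
  have int_eq: "integrable leb_pos (T_integrand H f x) \<longleftrightarrow> integrable leb_pos (T_integrand H' f' x)"
    if "0 < x" for x
    using that by (intro integrable_cong_AE meas T_integrand_cong_AE HH' f')
  have "AE z in leb_pos. ennreal (z powr (- 1 / p) * H z) = ennreal (z powr (- 1 / p) * H' z)"
    using HH' by eventually_elim simp
  then have phi_eq: "phi H p = phi H' p"
    unfolding phi_def by (rule nn_integral_cong_AE)
  obtain \<Phi> where \<Phi>: "phi H p = ennreal \<Phi>" "0 < \<Phi>"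
    using phi by (cases "phi H p") auto
  define K where "K x = (\<integral>\<^sup>+ z. ennreal (H' z * \<bar>f' (x * z)\<bar>) \<partial>leb_pos)" for x
  have K: "(\<integral>\<^sup>+ y. ennreal \<bar>T_integrand H' f' x y\<bar> \<partial>leb_pos) = K x" if "0 < x" for x
    unfolding K_def using that H'0 by (intro nn_integral_T_integrand borel_measurable_leb_pos) auto
  have Kint: "(\<integral>\<^sup>+ x. ennreal_powr (K x) p \<partial>leb_pos)
      \<le> ennreal (\<Phi> powr p) * (\<integral>\<^sup>+ x. ennreal (\<bar>f' x\<bar> powr p) \<partial>leb_pos)"
    unfolding K_def using H'0 p \<Phi> phi_eq by (intro nn_integral_kernel_powr_le) auto
  show "T_op H f \<in> borel_measurable leb_pos"
    using T_op_measurable_borel[of H' f'] by (subst measurable_cong[OF T_eq]) auto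
  have Lpf: "Lp_norm p f = Lp_norm p f'" by (rule Lp_norm_cong_AE[OF f'(2)])
  show "Lp_norm p (T_op H f) \<le> phi H p * Lp_norm p f"
  proof -
    have "ennreal (\<bar>T_op H f x\<bar> powr p) \<le> ennreal_powr (K x) p" if "0 < x" for x
    proof -
      have "ennreal (\<bar>T_op H f x\<bar> powr p) = ennreal_powr (ennreal \<bar>T_op H' f' x\<bar>) p"
        using that by (simp add: ennreal_powr_ennreal T_eq)
      also have "\<dots> \<le> ennreal_powr (K x) p"
        using p ennreal_abs_T_op_le[of H' f' x] K[OF that] by (intro ennreal_powr_mono) auto
      finally show ?thesis .
    qed
    then have "(\<integral>\<^sup>+ x. ennreal (\<bar>T_op H f x\<bar> powr p) \<partial>leb_pos) \<le> (\<integral>\<^sup>+ x. ennreal_powr (K x) p \<partial>leb_pos)"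
      by (intro nn_integral_mono) auto
    also note Kint
    finally have "Lp_norm p (T_op H f)
        \<le> ennreal_powr (ennreal (\<Phi> powr p) * (\<integral>\<^sup>+ x. ennreal (\<bar>f' x\<bar> powr p) \<partial>leb_pos)) (1 / p)"
      unfolding Lp_norm_def using p by (intro ennreal_powr_mono) auto
    also have "\<dots> = phi H p * Lp_norm p f"
      using p \<Phi> unfolding Lpf by (simp add: ennreal_powr_cmult Lp_norm_def powr_powr)
    finally show ?thesis .
  qed
  assume "Lp_norm p f < \<infinity>"
  then have "(\<integral>\<^sup>+ x. ennreal (\<bar>f' x\<bar> powr p) \<partial>leb_pos) < \<infinity>"
    unfolding Lpf by (auto simp: Lp_norm_def ennreal_powr_def less_top split: if_splits)
  then have "(\<integral>\<^sup>+ x. ennreal_powr (K x) p \<partial>leb_pos) < \<infinity>"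
    using Kint by (auto simp: ennreal_mult_less_top order_le_less_trans)
  moreover have "K \<in> borel_measurable borel"
    unfolding K_def nn_integral_leb_pos by measurable
  then have "(\<lambda>x. ennreal_powr (K x) p) \<in> borel_measurable leb_pos"
    by (intro borel_measurable_leb_pos) measurable
  ultimately have "AE x in leb_pos. ennreal_powr (K x) p \<noteq> \<infinity>"
    by (intro nn_integral_PInf_AE) auto
  then have "AE x in leb_pos. K x \<noteq> \<infinity>"
    by eventually_elim (auto simp: ennreal_powr_def)
  then show "AE x in leb_pos. integrable leb_pos (T_integrand H f x)"
    unfolding AE_leb_pos
  proof eventually_elim
    case (elim x)
    show ?case
    proof
      assume x: "0 < x"
      with elim K have "(\<integral>\<^sup>+ y. ennreal \<bar>T_integrand H' f' x y\<bar> \<partial>leb_pos) < \<infinity>"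
        by (simp add: less_top)
      then show "integrable leb_pos (T_integrand H f x)"
        unfolding int_eq[OF x] using meas[OF x] by (intro integrableI_bounded) auto
    qed
  qed
qed

text \<open>If \<open>phi H p\<close> were 0, then \<open>H\<close> would vanish almost everywhere
  and \<open>phi H q\<close> would be 0 too. Positivity makes division by \<open>phi H p\<close>
  meaningful.\<close>

lemma phi_pos:
  assumes H: "H \<in> borel_measurable leb_pos" "\<And>z. 0 < z \<Longrightarrow> 0 \<le> H z" and q: "phi H q = \<infinity>"
  shows "0 < phi H p"
proof (rule ccontr)
  have meas: "(\<lambda>z. ennreal (z powr (- 1 / r) * H z)) \<in> borel_measurable leb_pos" for r
    using H(1) borel_measurable_leb_pos[of "\<lambda>z. z powr (- 1 / r)"] by simp
  assume "\<not> 0 < phi H p"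
  then have "(\<integral>\<^sup>+ z. ennreal (z powr (- 1 / p) * H z) \<partial>leb_pos) = 0"
    by (simp add: phi_def)
  then have "AE z in leb_pos. ennreal (z powr (- 1 / p) * H z) = 0"
    using nn_integral_0_iff_AE[OF meas] by blast
  then have "AE z in leb_pos. ennreal (z powr (- 1 / q) * H z) = 0"
    unfolding AE_leb_pos
  proof eventually_elim
    case (elim z)
    then show ?case by (auto simp: ennreal_eq_0_iff mult_le_0_iff)
  qed
  then have "phi H q = 0"
    unfolding phi_def using nn_integral_0_iff_AE[OF meas] by blast
  with q show False by simp
qed

section \<open>Near-extremal functions and their weights\<close>

text \<open>The pure power \<open>y powr (- 1 / q)\<close> is a formal eigenfunction of the operator
  with eigenvalue \<open>phi H q\<close>; the cut at 1 and \<open>exp L\<close> puts it into every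
  L_p.\<close>

definition trunc_power :: "real \<Rightarrow> real \<Rightarrow> real \<Rightarrow> real" where
  "trunc_power q L y = indicator {1..exp L} y * y powr (- 1 / q)"

text \<open>A majorant in \<open>p\<close> of the \<open>L\<^sub>p\<close> norm of \<open>trunc_power q L\<close> which is sharp at \<open>p = q\<close>.\<close>

definition trunc_weight :: "real \<Rightarrow> real \<Rightarrow> real \<Rightarrow> real" where
  "trunc_weight q L p = exp (ln L * (1 / p) + L * max 0 (1 / p - 1 / q))"

lemma trunc_power_nonneg: "0 \<le> trunc_power q L y"
  by (simp add: trunc_power_def)

lemma trunc_power_measurable: "trunc_power q L \<in> borel_measurable leb_pos"
  unfolding trunc_power_def[abs_def] by (intro borel_measurable_leb_pos) measurable

lemma trunc_weight_ge_1:
  assumes "1 \<le> L" "0 \<le> p"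
  shows "1 \<le> trunc_weight q L p"
  using assms by (simp add: trunc_weight_def)

lemma trunc_weight_eq:
  assumes "1 \<le> L"
  shows "trunc_weight q L q = L powr (1 / q)"
  using assms by (simp add: trunc_weight_def powr_def)

lemma einterval_greater:
  assumes "ereal a \<le> A" "p \<in> einterval A B"
  shows "a < p"
proof -
  have "ereal a < ereal p"
    using assms by (intro le_less_trans[OF assms(1)]) (simp add: einterval_def)
  then show ?thesis by simp
qed

text \<open>The weight is a continuous function of \<open>1 / p\<close>, which has a finite limit at
  both end points, also when \<open>B\<close> is infinite. So both limits are finite, and they are
  positive as values of \<open>exp\<close>.\<close>

lemma trunc_weight_Psi:
  assumes AB: "1 \<le> A" "A < B" and L: "1 \<le> L"
  shows "trunc_weight q L \<in> Psi A B"
proof -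
  have ge: "1 \<le> trunc_weight q L p" if "p \<in> einterval A B" for p
    using einterval_greater[of 1 A p B] that AB L
    by (intro trunc_weight_ge_1) (auto simp: one_ereal_def)
  have cont: "isCont (trunc_weight q L) p" if "1 \<le> p" for p
    unfolding trunc_weight_def using that by (intro continuous_intros) auto
  obtain a where a: "A = ereal a" "1 \<le> a" using AB by (cases A) auto
  have "continuous_on (einterval A B) (trunc_weight q L)"
    by (intro continuous_at_imp_continuous_on ballI cont) (use a in \<open>auto simp: einterval_def\<close>)
  moreover have "\<forall>p\<in>einterval A B. 0 < trunc_weight q L p"
    by (simp add: trunc_weight_def)
  moreover have "1 \<le> (INF p\<in>einterval A B. ereal (trunc_weight q L p))"
    using ge by (intro INF_greatest) auto
  then have "0 < (INF p\<in>einterval A B. ereal (trunc_weight q L p))"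
    by (rule less_le_trans[rotated]) simp
  moreover have "\<exists>l>0. ((\<lambda>p. ereal (trunc_weight q L (real_of_ereal p))) \<longlongrightarrow> l) (at_right A)"
  proof (intro exI conjI)
    show "((\<lambda>p. ereal (trunc_weight q L (real_of_ereal p))) \<longlongrightarrow> ereal (trunc_weight q L a)) (at_right A)"
      unfolding a(1) at_right_ereal filterlim_filtermap
      using cont[OF a(2)] by (auto simp: isCont_def filterlim_at_split)
  qed (simp add: trunc_weight_def)
  moreover have "\<exists>l>0. ((\<lambda>p. ereal (trunc_weight q L (real_of_ereal p))) \<longlongrightarrow> l) (at_left B)"
  proof (cases B)
    case (real b)
    show ?thesis
    proof (intro exI conjI)
      have "1 \<le> b" using real a AB by simp
      from cont[OF this]
      show "((\<lambda>p. ereal (trunc_weight q L (real_of_ereal p))) \<longlongrightarrow> ereal (trunc_weight q L b)) (at_left B)"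
        unfolding real at_left_ereal filterlim_filtermap
        by (auto simp: isCont_def filterlim_at_split)
    qed (simp add: trunc_weight_def)
  next
    case PInf
    show ?thesis
    proof (intro exI conjI)
      have "((\<lambda>p::real. 1 / p) \<longlongrightarrow> 0) at_top"
        by (simp add: divide_inverse tendsto_inverse_0_at_top filterlim_ident)
      then have "(trunc_weight q L \<longlongrightarrow> exp (ln L * 0 + L * max 0 (0 - 1 / q))) at_top"
        unfolding trunc_weight_def[abs_def] by (intro tendsto_intros)
      then show "((\<lambda>p. ereal (trunc_weight q L (real_of_ereal p)))
          \<longlongrightarrow> ereal (exp (ln L * 0 + L * max 0 (0 - 1 / q)))) (at_left B)"
        unfolding PInf at_left_PInf filterlim_filtermap by simp
    qed simp
  next
    case MInf
    then show ?thesis using AB by simp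
  qed
  ultimately show ?thesis unfolding Psi_def by (intro CollectI conjI)
qed

lemma nn_integral_inverse:
  assumes "0 < a" "a \<le> b"
  shows "(\<integral>\<^sup>+ x. ennreal (indicator {a..b} x / x) \<partial>leb_pos) = ennreal (ln b - ln a)"
proof -
  have "(\<integral>\<^sup>+ x. ennreal (indicator {a..b} x / x) \<partial>leb_pos)
      = (\<integral>\<^sup>+ x. ennreal (1 / x) * indicator {a..b} x \<partial>lborel)"
    unfolding nn_integral_leb_pos using assms
    by (intro nn_integral_cong) (auto simp: indicator_def)
  also have "\<dots> = ennreal (ln b - ln a)"
    using assms by (intro nn_integral_FTC_Icc)
      (auto intro!: DERIV_subset[OF DERIV_ln_divide] simp: has_real_derivative_iff_has_vector_derivative[symmetric])
  finally show ?thesis .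
qed

lemma trunc_power_powr:
  assumes "0 < y"
  shows "\<bar>trunc_power q L y\<bar> powr p = indicator {1..exp L} y * y powr (- p / q)"
  using assms by (auto simp: trunc_power_def indicator_def powr_powr)

text \<open>With \<open>y = exp u\<close> the p-th power integral becomes that of
  \<open>exp ((1 - p / q) * u)\<close> over \<open>[0, L]\<close>, at most
  \<open>L * exp (L * m)\<close>. At \<open>p = q\<close> the exponent is 0 and nothing is
  lost.\<close>

lemma Lp_norm_trunc_power_le:
  assumes p: "0 < p" and q: "0 < q" and L: "1 \<le> L"
  shows "Lp_norm p (trunc_power q L) \<le> ennreal (trunc_weight q L p)"
proof -
  define m where "m = max 0 (1 - p / q)"
  have "(\<integral>\<^sup>+ y. ennreal (\<bar>trunc_power q L y\<bar> powr p) \<partial>leb_pos)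
    \<le> (\<integral>\<^sup>+ y. ennreal (exp (L * m)) * ennreal (indicator {1..exp L} y / y) \<partial>leb_pos)"
  proof (rule nn_integral_mono)
    fix y assume "y \<in> space leb_pos"
    then have y: "0 < y" by simp
    have "y powr (- p / q) \<le> exp (L * m) / y" if "y \<in> {1..exp L}"
    proof -
      have "0 \<le> ln y" "ln y \<le> L" using that y using ln_mono[of y "exp L"] by simp_all
      then have "(1 - p / q) * ln y \<le> L * m"
      proof -
        have "(1 - p / q) * ln y \<le> m * ln y" using \<open>0 \<le> ln y\<close> by (intro mult_right_mono) (auto simp: m_def)
        also have "\<dots> \<le> m * L" using \<open>ln y \<le> L\<close> by (intro mult_left_mono) (auto simp: m_def)
        finally show ?thesis by (simp add: mult.commute)
      qed
      then have "y powr (1 - p / q) \<le> exp (L * m)" using y by (simp add: powr_def)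
      then show ?thesis using y by (simp add: powr_diff powr_minus field_simps)
    qed
    then show "ennreal (\<bar>trunc_power q L y\<bar> powr p)
        \<le> ennreal (exp (L * m)) * ennreal (indicator {1..exp L} y / y)"
      unfolding trunc_power_powr[OF y] using y
      by (subst ennreal_mult[symmetric]) (auto simp: indicator_def intro!: ennreal_leI)
  qed
  also have "\<dots> = ennreal (exp (L * m) * L)"
    using L nn_integral_inverse[of 1 "exp L"]
    by (subst nn_integral_cmult) (auto intro!: borel_measurable_leb_pos simp: ennreal_mult)
  finally have "Lp_norm p (trunc_power q L) \<le> ennreal_powr (ennreal (exp (L * m) * L)) (1 / p)"
    unfolding Lp_norm_def using p by (intro ennreal_powr_mono) auto
  also have "\<dots> = ennreal ((exp (L * m) * L) powr (1 / p))"
    using L by (simp add: ennreal_powr_ennreal)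
  also have "(exp (L * m) * L) powr (1 / p) = trunc_weight q L p"
  proof -
    have "m / p = max 0 (1 / p - 1 / q)"
      using p q by (auto simp: m_def max_def field_simps)
    then have "m * (1 / p) = max 0 (1 / p - 1 / q)" by simp
    then show ?thesis using L p
      by (simp add: powr_def trunc_weight_def ln_mult algebra_simps flip: times_divide_eq_right)
  qed
  finally show ?thesis .
qed

lemma trunc_power_not_null:
  assumes "0 < L"
  shows "\<not> (AE y in leb_pos. trunc_power q L y = 0)"
proof
  assume "AE y in leb_pos. trunc_power q L y = 0"
  then have "AE y in leb_pos. ennreal (indicator {1..exp L} y / y) = 0"
    unfolding AE_leb_pos by eventually_elim (auto simp: trunc_power_def indicator_def split: if_splits)
  then have "(\<integral>\<^sup>+ y. ennreal (indicator {1..exp L} y / y) \<partial>leb_pos) = 0"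
    by (subst nn_integral_0_iff_AE) (auto intro!: borel_measurable_leb_pos)
  then show False using assms nn_integral_inverse[of 1 "exp L"] by simp
qed

section \<open>The lower bound at one exponent\<close>

text \<open>The window is symmetric in \<open>ln z\<close>, so the same argument serves a
  singularity of \<open>H\<close> at 0 and at infinity.\<close>

definition phi_trunc :: "(real \<Rightarrow> real) \<Rightarrow> real \<Rightarrow> real \<Rightarrow> ennreal" where
  "phi_trunc H q m = (\<integral>\<^sup>+ z. ennreal (z powr (- 1 / q) * H z) * indicator {exp (- m)..exp m} z \<partial>leb_pos)"

text \<open>Monotone convergence: the windows increase to the whole half-line.\<close>

lemma phi_trunc_tendsto:
  assumes "H \<in> borel_measurable leb_pos"
  shows "(\<lambda>n. phi_trunc H q (real n)) \<longlonglongrightarrow> phi H q"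
proof -
  have "(\<lambda>n. \<integral>\<^sup>+ z. ennreal (z powr (- 1 / q) * H z) * indicator {exp (- real n)..exp (real n)} z \<partial>leb_pos)
    \<longlonglongrightarrow> (\<integral>\<^sup>+ z. ennreal (z powr (- 1 / q) * H z) * indicator {0<..} z \<partial>leb_pos)"
  proof (rule nn_integral_LIMSEQ)
    show "incseq (\<lambda>n z. ennreal (z powr (- 1 / q) * H z) * indicator {exp (- real n)..exp (real n)} z)"
    proof (intro incseq_SucI le_funI mult_left_mono)
      fix n z
      have "{exp (- real n)..exp (real n)} \<subseteq> {exp (- real (Suc n))..exp (real (Suc n))}"
        by (subst atLeastatMost_subset_iff) simp
      from subsetD[OF this, of z] show "indicator {exp (- real n)..exp (real n)} z
          \<le> (indicator {exp (- real (Suc n))..exp (real (Suc n))} z :: ennreal)"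
        by (auto simp: indicator_def)
    qed simp
    show "(\<lambda>z. ennreal (z powr (- 1 / q) * H z) * indicator {exp (- real n)..exp (real n)} z)
        \<in> borel_measurable leb_pos" for n
      using assms borel_measurable_leb_pos[of "\<lambda>z. z powr (- 1 / q)"]
        borel_measurable_leb_pos[of "indicator {exp (- real n)..exp (real n)} :: real \<Rightarrow> ennreal"] by simp
    fix z :: real
    have "\<forall>\<^sub>F n in sequentially. indicator {exp (- real n)..exp (real n)} z = (indicator {0<..} z :: ennreal)"
    proof (cases "0 < z")
      case True
      obtain N where N: "\<bar>ln z\<bar> \<le> real N" using real_arch_simple by blast
      have "\<forall>\<^sub>F n in sequentially. N \<le> n" by (rule eventually_ge_at_top)
      then show ?thesis
      proof eventually_elim
        case (elim n)
        with N have "- real n \<le> ln z" "ln z \<le> real n" by auto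
        then have "exp (- real n) \<le> exp (ln z)" "exp (ln z) \<le> exp (real n)" by simp_all
        with True show ?case by simp
      qed
    next
      case False
      then have "z < exp (- real n)" for n by (intro le_less_trans[of z 0]) auto
      then have "z \<notin> {exp (- real n)..exp (real n)}" for n by (simp add: not_le)
      with False show ?thesis by simp
    qed
    then have "\<forall>\<^sub>F n in sequentially. ennreal (z powr (- 1 / q) * H z) * indicator {exp (- real n)..exp (real n)} z
       = ennreal (z powr (- 1 / q) * H z) * indicator {0<..} z"
      by eventually_elim simp
    then show "(\<lambda>n. ennreal (z powr (- 1 / q) * H z) * indicator {exp (- real n)..exp (real n)} z)
      \<longlonglongrightarrow> ennreal (z powr (- 1 / q) * H z) * indicator {0<..} z"
      by (rule tendsto_eventually)
  qed
  also have "(\<integral>\<^sup>+ z. ennreal (z powr (- 1 / q) * H z) * indicator {0<..} z \<partial>leb_pos) = phi H q"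
    unfolding phi_def by (intro nn_integral_cong) simp
  finally show ?thesis unfolding phi_trunc_def .
qed

text \<open>For \<open>x\<close> in \<open>[exp m, exp (L - m)]\<close> and \<open>z\<close> in the
  window, \<open>x * z\<close> stays in \<open>[1, exp L]\<close>, where the truncated power is
  multiplicative. Hence the operator is at least \<open>\<kappa> * x powr (- 1 / q)\<close> there,
  and the integral of \<open>1 / x\<close> over this range is \<open>L - 2 * m\<close>.\<close>

lemma Lp_norm_T_op_trunc_power_ge:
  assumes H: "H \<in> borel_measurable leb_pos" "\<And>z. 0 < z \<Longrightarrow> 0 \<le> H z"
    and q: "1 < q" and phi: "0 < phi H q" "phi H q < \<infinity>"
    and m: "0 \<le> m" "2 * m \<le> L" "1 \<le> L"
    and \<kappa>: "phi_trunc H q m = ennreal \<kappa>" "0 \<le> \<kappa>"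
  shows "ennreal (\<kappa> * (L - 2 * m) powr (1 / q)) \<le> Lp_norm q (T_op H (trunc_power q L))"
proof -
  let ?f = "trunc_power q L"
  note f = trunc_power_measurable[of q L]
  have "Lp_norm q ?f < \<infinity>"
    using q m by (intro le_less_trans[OF Lp_norm_trunc_power_le]) auto
  \<comment> \<open>A lower bound requires \<open>T_op\<close> to be the true integral and not the
    default value 0.\<close>
  then have "AE x in leb_pos. integrable leb_pos (T_integrand H ?f x)"
    using H q phi f by (intro AE_integrable_T_integrand)
  then have AE_ge: "AE x in leb_pos. ennreal (\<kappa> powr q) * ennreal (indicator {exp m..exp (L - m)} x / x)
      \<le> ennreal (\<bar>T_op H ?f x\<bar> powr q)"
    unfolding AE_leb_pos
  proof eventually_elim
    case (elim x)
    show ?case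
    proof (intro impI)
      assume x: "0 < x"
      show "ennreal (\<kappa> powr q) * ennreal (indicator {exp m..exp (L - m)} x / x)
        \<le> ennreal (\<bar>T_op H ?f x\<bar> powr q)"
      proof (cases "x \<in> {exp m..exp (L - m)}")
        case True
        have "ennreal (\<kappa> * x powr (- 1 / q))
          = (\<integral>\<^sup>+ z. ennreal (x powr (- 1 / q)) * (ennreal (z powr (- 1 / q) * H z) * indicator {exp (- m)..exp m} z) \<partial>leb_pos)"
          using \<kappa> H(1) borel_measurable_leb_pos[of "\<lambda>z. z powr (- 1 / q)"]
            borel_measurable_leb_pos[of "indicator {exp (- m)..exp m} :: real \<Rightarrow> ennreal"]
          by (subst nn_integral_cmult) (auto simp: phi_trunc_def ennreal_mult mult.commute)
        also have "\<dots> \<le> (\<integral>\<^sup>+ z. ennreal (H z * \<bar>?f (x * z)\<bar>) \<partial>leb_pos)"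
        proof (rule nn_integral_mono)
          fix z assume "z \<in> space leb_pos"
          then have z: "0 < z" by simp
          have "x * z \<in> {1..exp L}" if "z \<in> {exp (- m)..exp m}"
          proof -
            have "exp m * exp (- m) \<le> x * z" "x * z \<le> exp (L - m) * exp m"
              using that True x z by (auto intro!: mult_mono simp del: exp_minus)
            then show ?thesis by (simp flip: exp_add)
          qed
          then show "ennreal (x powr (- 1 / q)) * (ennreal (z powr (- 1 / q) * H z) * indicator {exp (- m)..exp m} z)
            \<le> ennreal (H z * \<bar>?f (x * z)\<bar>)"
            using x z H(2)[OF z]
            by (auto simp: indicator_def trunc_power_def powr_mult mult_ac simp flip: ennreal_mult)
        qed
        also have "\<dots> = (\<integral>\<^sup>+ y. ennreal \<bar>T_integrand H ?f x y\<bar> \<partial>leb_pos)"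
          using H f x by (intro nn_integral_T_integrand[symmetric])
        also have "\<dots> = (\<integral>\<^sup>+ y. ennreal (T_integrand H ?f x y) \<partial>leb_pos)"
          using x H(2) trunc_power_nonneg by (intro nn_integral_cong) (simp add: T_integrand_def)
        also have "\<dots> = ennreal (T_op H ?f x)"
          unfolding T_op_def
        proof (rule nn_integral_eq_integral)
          show "integrable leb_pos (T_integrand H ?f x)" using elim x by simp
          show "AE y in leb_pos. 0 \<le> T_integrand H ?f x y"
            using x H(2) trunc_power_nonneg by (intro AE_I2) (simp add: T_integrand_def)
        qed
        finally have "\<kappa> * x powr (- 1 / q) \<le> \<bar>T_op H ?f x\<bar>"
          using \<kappa> by (subst (asm) ennreal_le_iff2) auto
        then have "(\<kappa> * x powr (- 1 / q)) powr q \<le> \<bar>T_op H ?f x\<bar> powr q"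
          using \<kappa> q by (intro powr_mono2) auto
        also have "(\<kappa> * x powr (- 1 / q)) powr q = \<kappa> powr q * (x powr (- 1 / q)) powr q"
          by (rule powr_mult)
        also have "(x powr (- 1 / q)) powr q = x powr (- 1)"
          unfolding powr_powr using q by simp
        also have "x powr (- 1) = 1 / x" using x by (simp add: powr_minus_divide)
        finally show ?thesis using True x by (simp flip: ennreal_mult)
      qed simp
    qed
  qed
  have "ennreal (\<kappa> powr q * (L - 2 * m))
      = (\<integral>\<^sup>+ x. ennreal (\<kappa> powr q) * ennreal (indicator {exp m..exp (L - m)} x / x) \<partial>leb_pos)"
    using m nn_integral_inverse[of "exp m" "exp (L - m)"]
    by (subst nn_integral_cmult) (auto intro!: borel_measurable_leb_pos simp: ennreal_mult)
  also have "\<dots> \<le> (\<integral>\<^sup>+ x. ennreal (\<bar>T_op H ?f x\<bar> powr q) \<partial>leb_pos)"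
    by (rule nn_integral_mono_AE[OF AE_ge])
  finally have "ennreal_powr (ennreal (\<kappa> powr q * (L - 2 * m))) (1 / q) \<le> Lp_norm q (T_op H ?f)"
    unfolding Lp_norm_def using q by (intro ennreal_powr_mono) auto
  then show ?thesis
    using q m \<kappa> by (simp add: ennreal_powr_ennreal powr_mult powr_powr)
qed

section \<open>The norms of the spaces G and the sharp constant\<close>

lemma one_le_inverse_ennreal:
  fixes x :: ennreal
  assumes "x \<le> 1"
  shows "1 \<le> inverse x"
proof (cases x)
  case (real r)
  with assms show ?thesis
    by (cases "r = 0") (simp_all add: inverse_ennreal one_le_inverse)
next
  case top
  with assms show ?thesis by (simp add: top_unique)
qed

text \<open>The comparison holds at each exponent separately: the factor \<open>phi H p\<close> of
  the L_p bound is the one in the new weight.\<close>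

lemma G_norm_T_op_le:
  assumes H: "H \<in> borel_measurable leb_pos" "\<And>z. 0 < z \<Longrightarrow> 0 \<le> H z"
    and f: "f \<in> borel_measurable leb_pos"
    and AB: "\<And>p. p \<in> einterval A B \<Longrightarrow> 1 < p \<and> 0 < phi H p \<and> phi H p < \<infinity> \<and> 0 < \<psi> p"
  shows "G_norm A B (\<lambda>p. phi H p * ennreal (\<psi> p)) (T_op H f) \<le> G_norm A B (\<lambda>p. ennreal (\<psi> p)) f"
  unfolding G_norm_def
proof (rule SUP_mono)
  fix p assume p: "p \<in> einterval A B"
  note pp = AB[OF p]
  have "Lp_norm p (T_op H f) \<le> phi H p * Lp_norm p f"
    using pp by (intro Lp_norm_T_op_le H f) auto
  also have "Lp_norm p f = ennreal (\<psi> p) * (Lp_norm p f / ennreal (\<psi> p))"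
    using pp by (simp add: ennreal_times_divide mult_divide_eq_ennreal mult.commute[of "ennreal (\<psi> p)"])
  finally have "Lp_norm p (T_op H f) / (phi H p * ennreal (\<psi> p)) \<le> Lp_norm p f / ennreal (\<psi> p)"
    using pp by (intro divide_le_posI_ennreal) (auto simp: ennreal_zero_less_mult_iff mult.assoc)
  then show "\<exists>p'\<in>einterval A B. Lp_norm p (T_op H f) / (phi H p * ennreal (\<psi> p))
      \<le> Lp_norm p' f / ennreal (\<psi> p')"
    using p by blast
qed

text \<open>A single exponent suffices: a finite G-norm forces a finite L_p norm at
  \<open>p\<close>, as the weight is finite there.\<close>

lemma AE_integrable_T_integrand_G_space:
  assumes H: "H \<in> borel_measurable leb_pos" "\<And>z. 0 < z \<Longrightarrow> 0 \<le> H z"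
    and f: "f \<in> G_space A B (\<lambda>p. ennreal (\<psi> p))"
    and p: "p \<in> einterval A B" "1 < p" "0 < phi H p" "phi H p < \<infinity>"
  shows "AE x in leb_pos. integrable leb_pos (T_integrand H f x)"
proof (rule AE_integrable_T_integrand[OF H _ p(2,3,4)])
  show "f \<in> borel_measurable leb_pos" using f by (simp add: G_space_def)
  have "Lp_norm p f / ennreal (\<psi> p) \<le> G_norm A B (\<lambda>p. ennreal (\<psi> p)) f"
    unfolding G_norm_def using p(1) by (rule SUP_upper)
  also have "\<dots> < \<infinity>" using f by (simp add: G_space_def)
  finally show "Lp_norm p f < \<infinity>"
    by (cases "Lp_norm p f") (auto simp: ennreal_top_divide)
qed

text \<open>The G-norm of the image is at least its quotient at the single exponent
  \<open>q\<close>, while the G-norm of \<open>f\<close> is at most 1. The resulting lower bounds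
  tend to 1.\<close>

lemma SUP_G_norm_ratio_ge_1:
  assumes H: "H \<in> borel_measurable leb_pos" "\<And>z. 0 < z \<Longrightarrow> 0 \<le> H z"
    and AB: "1 \<le> A" "A < B" and q: "q \<in> einterval A B" "0 < phi H q" "phi H q < \<infinity>"
  shows "1 \<le> (SUP \<psi>\<in>Psi A B.
         SUP f\<in>{f \<in> G_space A B (\<lambda>p. ennreal (\<psi> p)). \<not> (AE x in leb_pos. f x = 0)}.
           G_norm A B (\<lambda>p. phi H p * ennreal (\<psi> p)) (T_op H f)
             / G_norm A B (\<lambda>p. ennreal (\<psi> p)) f)" (is "1 \<le> ?S")
proof -
  have gt1: "1 < p" if "p \<in> einterval A B" for p
    using einterval_greater[of 1 A p B] that AB by (simp add: one_ereal_def)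
  note q1 = gt1[OF q(1)]
  obtain \<Phi> where \<Phi>: "phi H q = ennreal \<Phi>" "0 < \<Phi>"
    using q by (cases "phi H q") auto
  define \<kappa> where "\<kappa> n = enn2real (phi_trunc H q (real n))" for n
  have "phi_trunc H q m \<le> phi H q" for m
    unfolding phi_trunc_def phi_def by (intro nn_integral_mono) (auto simp: indicator_def)
  then have "phi_trunc H q m < top" for m
    using q(3) le_less_trans by fastforce
  then have \<kappa>: "phi_trunc H q (real n) = ennreal (\<kappa> n)" "0 \<le> \<kappa> n" for n
    by (simp_all add: \<kappa>_def)
  have "(\<lambda>n. ennreal (\<kappa> n)) \<longlonglongrightarrow> ennreal \<Phi>"
    using phi_trunc_tendsto[OF H(1), of q] by (simp add: \<kappa> \<Phi>)
  then have \<kappa>_lim: "\<kappa> \<longlonglongrightarrow> \<Phi>"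
    using \<kappa> \<Phi> by (subst (asm) tendsto_ennreal_iff) auto
  \<comment> \<open>The lower bound for the L_q norm of the image, divided by \<open>phi H q\<close>
    times the weight at \<open>q\<close>. Here \<open>1 - 2 / n\<close> is
    \<open>(L - 2 * n) / L\<close> for \<open>L\<close> equal to the square of
    \<open>n\<close>.\<close>
  define r where "r n = \<kappa> n / \<Phi> * (1 - 2 / real n) powr (1 / q)" for n
  have "(\<lambda>n::nat. 1 - 2 / real n) \<longlonglongrightarrow> 1 - 0"
    by (intro tendsto_diff tendsto_const lim_const_over_n)
  then have "r \<longlonglongrightarrow> \<Phi> / \<Phi> * (1 - 0) powr (1 / q)"
    unfolding r_def using \<Phi> by (intro tendsto_intros \<kappa>_lim) auto
  then have r_lim: "(\<lambda>n. ennreal (r n)) \<longlonglongrightarrow> ennreal 1"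
    using \<Phi> by (intro tendsto_ennrealI) simp
  have r_le: "ennreal (r n) \<le> ?S" if n: "2 \<le> n" for n
  proof -
    \<comment> \<open>The logarithmic length must outgrow the window size \<open>n\<close>, so that
      the lost fraction \<open>2 * n / L\<close> tends to 0; \<open>2 \<le> n\<close> gives
      \<open>2 * n \<le> L\<close>.\<close>
    define L where "L = (real n)\<^sup>2"
    have "2 * real n \<le> L" using n by (simp add: L_def power2_eq_square)
    then have L: "1 \<le> L" "2 * real n \<le> L" using n by auto
    define f \<psi> where "f = trunc_power q L" and "\<psi> = trunc_weight q L"
    have \<psi>: "\<psi> \<in> Psi A B" unfolding \<psi>_def using AB L by (intro trunc_weight_Psi)
    have \<psi>0: "0 < \<psi> p" for p by (simp add: \<psi>_def trunc_weight_def)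
    have G_le: "G_norm A B (\<lambda>p. ennreal (\<psi> p)) f \<le> 1"
      unfolding G_norm_def
    proof (rule SUP_least)
      fix p assume "p \<in> einterval A B"
      from gt1[OF this] have "Lp_norm p f \<le> ennreal (\<psi> p)"
        unfolding f_def \<psi>_def using L q1 by (intro Lp_norm_trunc_power_le) auto
      then show "Lp_norm p f / ennreal (\<psi> p) \<le> 1"
        using \<psi>0[of p] by (intro divide_le_posI_ennreal) auto
    qed
    then have "f \<in> G_space A B (\<lambda>p. ennreal (\<psi> p))"
      by (auto simp: G_space_def f_def trunc_power_measurable intro: le_less_trans)
    moreover have "\<not> (AE x in leb_pos. f x = 0)"
      unfolding f_def using L by (intro trunc_power_not_null) simp
    ultimately have f: "f \<in> {f \<in> G_space A B (\<lambda>p. ennreal (\<psi> p)). \<not> (AE x in leb_pos. f x = 0)}"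
      by simp
    have "r n * (\<Phi> * \<psi> q) = \<kappa> n * (L - 2 * real n) powr (1 / q)"
    proof -
      have "1 - 2 / real n = (L - 2 * real n) / L"
        using n by (simp add: L_def power2_eq_square field_simps)
      then show ?thesis
        using \<Phi> L by (simp add: r_def \<psi>_def trunc_weight_eq powr_divide)
    qed
    then have "r n = \<kappa> n * (L - 2 * real n) powr (1 / q) / (\<Phi> * \<psi> q)"
      using \<Phi> \<psi>0[of q] by (metis mult_pos_pos nonzero_mult_div_cancel_right less_irrefl)
    then have "ennreal (r n) = ennreal (\<kappa> n * (L - 2 * real n) powr (1 / q)) / (phi H q * ennreal (\<psi> q))"
      using \<Phi> \<psi>0[of q] \<kappa>(2)[of n] by (simp add: divide_ennreal flip: ennreal_mult)
    also have "\<dots> \<le> Lp_norm q (T_op H f) / (phi H q * ennreal (\<psi> q))"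
      unfolding f_def using L q1
      by (intro divide_right_mono_ennreal Lp_norm_T_op_trunc_power_ge H q \<kappa>) auto
    also have "\<dots> \<le> G_norm A B (\<lambda>p. phi H p * ennreal (\<psi> p)) (T_op H f)"
      unfolding G_norm_def using q(1) by (rule SUP_upper)
    \<comment> \<open>Dividing by a norm that is at most 1 cannot decrease the value.\<close>
    also have "G_norm A B (\<lambda>p. phi H p * ennreal (\<psi> p)) (T_op H f)
        \<le> G_norm A B (\<lambda>p. phi H p * ennreal (\<psi> p)) (T_op H f) / G_norm A B (\<lambda>p. ennreal (\<psi> p)) f"
    proof -
      have "1 \<le> inverse (G_norm A B (\<lambda>p. ennreal (\<psi> p)) f)"
        using G_le by (rule one_le_inverse_ennreal)
      from mult_left_mono[OF this] show ?thesis by (simp add: divide_ennreal_def)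
    qed
    also have "\<dots> \<le> ?S"
      by (rule SUP_upper2[OF \<psi>]) (rule SUP_upper[OF f])
    finally show ?thesis .
  qed
  have "ennreal 1 \<le> ?S"
    by (rule LIMSEQ_le_const2[OF r_lim]) (use r_le in blast)
  then show ?thesis by simp
qed

text \<open>Integrability almost everywhere is part of the conclusion, so that \<open>T_op\<close>
  there is a convergent integral and not a default value.\<close>

theorem theorem4:
  fixes \<alpha> :: real and H :: "real \<Rightarrow> real" and A B :: ereal
  assumes "0 < \<alpha>" and "\<alpha> < 1"
    and "H \<in> borel_measurable leb_pos" and "\<And>z. 0 < z \<Longrightarrow> 0 \<le> H z"
    and "(singular_at_zero \<alpha> H \<and> A = ereal (1 / \<alpha>) \<and> B = \<infinity>)
       \<or> (singular_at_infinity \<alpha> H \<and> A = 1 \<and> B = ereal (1 / \<alpha>))"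
  shows "(\<forall>\<psi>\<in>Psi A B. \<forall>f\<in>G_space A B (\<lambda>p. ennreal (\<psi> p)).
            (AE x in leb_pos. integrable leb_pos (T_integrand H f x))
            \<and> T_op H f \<in> borel_measurable leb_pos
            \<and> G_norm A B (\<lambda>p. phi H p * ennreal (\<psi> p)) (T_op H f)
                \<le> G_norm A B (\<lambda>p. ennreal (\<psi> p)) f)
    \<and> (SUP \<psi>\<in>Psi A B.
         SUP f\<in>{f \<in> G_space A B (\<lambda>p. ennreal (\<psi> p)). \<not> (AE x in leb_pos. f x = 0)}.
           G_norm A B (\<lambda>p. phi H p * ennreal (\<psi> p)) (T_op H f)
             / G_norm A B (\<lambda>p. ennreal (\<psi> p)) f) = 1"
proof -
  note H = assms(3,4)
  have \<alpha>: "1 < 1 / \<alpha>" using assms(1,2) by simp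
  have AB: "1 \<le> A" "A < B"
    using assms(5) \<alpha> by (auto simp: one_ereal_def)
  have fin: "1 < p \<and> phi H p < \<infinity>" if "p \<in> einterval A B" for p
    using assms(5) that \<alpha>
    by (auto simp: singular_at_zero_def singular_at_infinity_def einterval_def one_ereal_def)
  \<comment> \<open>The critical exponent exceeds 1 and fails the strict inequality in both cases,
    so \<open>phi H\<close> diverges there; \<open>phi_pos\<close> then applies.\<close>
  have "\<not> phi H (1 / \<alpha>) < \<infinity>"
    using assms(5) \<alpha> by (auto simp: singular_at_zero_def singular_at_infinity_def)
  then have "phi H (1 / \<alpha>) = \<infinity>" by (simp add: less_top[symmetric])
  then have pos: "0 < phi H p" for p using H by (intro phi_pos)
  obtain q where "A < ereal q" "ereal q < B" using ereal_dense2[OF AB(2)] by auto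
  then have q: "q \<in> einterval A B" by (simp add: einterval_def)
  have bound: "(AE x in leb_pos. integrable leb_pos (T_integrand H f x))
      \<and> T_op H f \<in> borel_measurable leb_pos
      \<and> G_norm A B (\<lambda>p. phi H p * ennreal (\<psi> p)) (T_op H f) \<le> G_norm A B (\<lambda>p. ennreal (\<psi> p)) f"
    if "\<psi> \<in> Psi A B" "f \<in> G_space A B (\<lambda>p. ennreal (\<psi> p))" for \<psi> f
  proof (intro conjI)
    have f: "f \<in> borel_measurable leb_pos" using that(2) by (simp add: G_space_def)
    show "AE x in leb_pos. integrable leb_pos (T_integrand H f x)"
      using fin[OF q] pos by (intro AE_integrable_T_integrand_G_space[OF H that(2) q]) auto
    show "T_op H f \<in> borel_measurable leb_pos"
      using fin[OF q] pos by (intro T_op_measurable[OF H f, of q]) auto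
    show "G_norm A B (\<lambda>p. phi H p * ennreal (\<psi> p)) (T_op H f) \<le> G_norm A B (\<lambda>p. ennreal (\<psi> p)) f"
      using fin pos that(1) by (intro G_norm_T_op_le H f) (auto simp: Psi_def)
  qed
  have "(SUP \<psi>\<in>Psi A B.
         SUP f\<in>{f \<in> G_space A B (\<lambda>p. ennreal (\<psi> p)). \<not> (AE x in leb_pos. f x = 0)}.
           G_norm A B (\<lambda>p. phi H p * ennreal (\<psi> p)) (T_op H f)
             / G_norm A B (\<lambda>p. ennreal (\<psi> p)) f) \<le> 1"
  proof (intro SUP_least)
    fix \<psi> f assume \<psi>: "\<psi> \<in> Psi A B"
      and f: "f \<in> {f \<in> G_space A B (\<lambda>p. ennreal (\<psi> p)). \<not> (AE x in leb_pos. f x = 0)}"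
    then have le: "G_norm A B (\<lambda>p. phi H p * ennreal (\<psi> p)) (T_op H f) \<le> G_norm A B (\<lambda>p. ennreal (\<psi> p)) f"
      using bound by blast
    show "G_norm A B (\<lambda>p. phi H p * ennreal (\<psi> p)) (T_op H f) / G_norm A B (\<lambda>p. ennreal (\<psi> p)) f \<le> 1"
    \<comment> \<open>If the denominator is 0, so is the numerator by \<open>le\<close>, and
      \<open>0 / 0 = 0\<close> in \<open>ennreal\<close>.\<close>
    proof (cases "G_norm A B (\<lambda>p. ennreal (\<psi> p)) f = 0")
      case True
      with le show ?thesis by simp
    next
      case False
      with le show ?thesis by (intro divide_le_posI_ennreal) (auto simp: zero_less_iff_neq_zero)
    qed
  qed
  moreover have "1 \<le> (SUP \<psi>\<in>Psi A B.
         SUP f\<in>{f \<in> G_space A B (\<lambda>p. ennreal (\<psi> p)). \<not> (AE x in leb_pos. f x = 0)}.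
           G_norm A B (\<lambda>p. phi H p * ennreal (\<psi> p)) (T_op H f)
             / G_norm A B (\<lambda>p. ennreal (\<psi> p)) f)"
    using fin[OF q] pos by (intro SUP_G_norm_ratio_ge_1[OF H AB q]) auto
  ultimately show ?thesis using bound by (intro conjI ballI order.antisym) simp_all
qed

end
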